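(* Let $f(x;\mu)$ be a regular exponential family and $g(x;\mu,\lambda)$ the corresponding local mixture model of order $r$. Also, assume that the compact covering $\{M(\mu)\}$ satisfies $|M(\mu)|=O(\varepsilon^{1/2})$. For each $\mu$, let $\Lambda(M(\mu))$ be defined by $$\Lambda(M(\mu)):=\{\Phi(Q)\mid Q\in\mathcal{Q}^{\mathrm{dis}}_{M(\mu)}\}.$$ Suppose further that for all $Q\in\mathcal{Q}^{\mathrm{dis}}_{M(\mu)}$, $$g(x_i;\mu,\Phi(Q))\ge C>0$$ for every observed data point $x_i$. Under these assumptions, there exists a prior $\pi(\mu,\lambda)$, depending on $\pi(\mu,Q)$, such that $R_2(\varepsilon)$ bounds $$\left|\int_{\mathcal{Q}^{\mathrm{dis}}_{M(\mu)}}\left\{\prod_{i=1}^{n}\int_{M(\mu)}f(x_i;m)\,\mathrm{d}Q(m)\,\pi(\mu,Q)\right\}\mathrm{d}P(Q)-\int_{\Lambda(M(\mu))}\left\{\prod_{i=1}^{n}g(x_i;\mu,\lambda)\,\pi(\mu,\lambda)\right\}\mathrm{d}P(\lambda)\right|,$$ where $R_2(\varepsilon)=O(\varepsilon^{(r+1)/2})$.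
   Context: A univariate exponential family on $\mathbf{R}$ has, in terms of its natural parameter $\theta$, the form $\exp\{\theta x-k_\nu(\theta)\}\nu(x)$ with respect to some $\sigma$-finite measure $\nu$; its mean (expected) parameter is $\mu=\mathrm{E}(X)$, and $f(x;\mu)$ denotes the family in the mean parametrization. Standard regularity conditions on parametric families are assumed throughout; under them $f(\cdot;\mu)\in L^2(\nu)$ with $\int f\,\mathrm{d}\nu=1$, and all $\mu$-derivatives of $f$ are in $L^2(\nu)$ with integral $0$. The local mixture model of order $r$ of $f(x;\mu)$ is $$g(x;\mu,\lambda)=f(x;\mu)+\sum_{k=2}^{r}\lambda_k f^{(k)}(x;\mu),\qquad f^{(k)}(x;\mu)=\frac{\partial^k}{\partial\mu^k}f(x;\mu),\quad \lambda=(\lambda_2,\dots,\lambda_r).$$ The compact covering $\{M(\mu)\}$ is a family of compact subsets of the mean parameter space such that $\mu\in M(\mu)$, with length $|M(\mu)|=\max M(\mu)-\min M(\mu)$. $\mathcal{Q}_{M(\mu)}$ is the set of distributions which have support on $M(\mu)$ and have expected value $\mu$, and $\mathcal{Q}^{\mathrm{dis}}_{M(\mu)}$ is the subset of $\mathcal{Q}_{M(\mu)}$ defined by the finite mixtures (discrete distributions with finitely many support points). The weighted moment map is $$\Phi(Q)=\left(\frac{\mathrm{E}_Q((\theta-\mu)^2)}{2!},\dots,\frac{\mathrm{E}_Q((\theta-\mu)^r)}{r!}\right).$$ Here $x_1,\dots,x_n$ are the observed data, $\pi(\mu,Q)$ is a prior, $\mathrm{d}P(Q)$ is a measure over the class of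 mixing distributions $\mathcal{Q}^{\mathrm{dis}}_{M(\mu)}$, and $\mathrm{d}P(\lambda)$ denotes the corresponding integration over $\lambda\in\Lambda(M(\mu))$. The $O(\cdot)$ statements refer to the small parameter $\varepsilon$.
   Formalization: Two conditions are added, without which the claim fails for a prior not depending on the data: the measure dP(λ), the image of dP(Q) under Φ, is σ-finite; and the prior mass ∫π(μ,Q)dP(Q) is finite and O(1) as ε→0. All bounds are for each fixed μ. *)

theory Defs
  imports "HOL-Probability.Probability"
begin

section \<open>Univariate exponential families in the mean parametrization\<close>

definition natural_space :: "real measure \<Rightarrow> real set" where
  "natural_space \<nu> = {\<theta>. integrable \<nu> (\<lambda>x. exp (\<theta> * x))}"

definition cumulant :: "real measure \<Rightarrow> real \<Rightarrow> real" where
  "cumulant \<nu> \<theta> = ln (\<integral>x. exp (\<theta> * x) \<partial>\<nu>)"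

definition natural_density :: "real measure \<Rightarrow> real \<Rightarrow> real \<Rightarrow> real" where
  "natural_density \<nu> x \<theta> = exp (\<theta> * x - cumulant \<nu> \<theta>)"

definition mean_of :: "real measure \<Rightarrow> real \<Rightarrow> real" where
  "mean_of \<nu> \<theta> = (\<integral>x. x * natural_density \<nu> x \<theta> \<partial>\<nu>)"

definition mean_space :: "real measure \<Rightarrow> real set" where
  "mean_space \<nu> = mean_of \<nu> ` natural_space \<nu>"

text \<open>On \<^term>\<open>natural_space \<nu>\<close> the map \<^term>\<open>mean_of \<nu>\<close> is injective for a regular family, so
  \<^const>\<open>inv_into\<close> below is the actual inverse reparametrization.\<close>

definition mean_density :: "real measure \<Rightarrow> real \<Rightarrow> real \<Rightarrow> real" where
  "mean_density \<nu> x \<mu> = natural_density \<nu> x (inv_into (natural_space \<nu>) (mean_of \<nu>) \<mu>)"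

text \<open>Regular in the sense of Barndorff-Nielsen: the natural parameter ranges over the whole
  natural parameter space, which is open. A dominating measure concentrated at one point is
  excluded, as all its densities would coincide.\<close>

definition regular_exponential_family :: "real measure \<Rightarrow> bool" where
  "regular_exponential_family \<nu> \<longleftrightarrow>
     sets \<nu> = sets borel \<and> sigma_finite_measure \<nu> \<and>
     \<not> (\<exists>c. AE x in \<nu>. x = c) \<and>
     natural_space \<nu> \<noteq> {} \<and> open (natural_space \<nu>)"

definition param_deriv :: "(real \<Rightarrow> real \<Rightarrow> real) \<Rightarrow> nat \<Rightarrow> real \<Rightarrow> real \<Rightarrow> real" where
  "param_deriv f k x \<mu> = (deriv ^^ k) (f x) \<mu>"

text \<open>The standing regularity conditions for a parametric family of \<open>\<nu>\<close>-densities
  \<open>f x \<mu>\<close> with parameter set \<open>S\<close>.\<close>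

definition regular_parametric_family ::
    "real measure \<Rightarrow> real set \<Rightarrow> (real \<Rightarrow> real \<Rightarrow> real) \<Rightarrow> bool" where
  "regular_parametric_family \<nu> S f \<longleftrightarrow>
     open S \<and>
     (\<forall>\<mu>\<in>S. \<forall>k x. (\<lambda>m. param_deriv f k x m) differentiable at \<mu>) \<and>
     (\<forall>\<mu>\<in>S. \<forall>k. integrable \<nu> (\<lambda>x. (param_deriv f k x \<mu>)\<^sup>2)) \<and>
     (\<forall>\<mu>\<in>S. has_bochner_integral \<nu> (\<lambda>x. f x \<mu>) 1) \<and>
     (\<forall>\<mu>\<in>S. \<forall>k\<ge>1. has_bochner_integral \<nu> (\<lambda>x. param_deriv f k x \<mu>) 0)"


section \<open>Local mixture models\<close>

text \<open>The parameter vector \<open>(\<lambda>\<^sub>2, \<dots>, \<lambda>\<^sub>r)\<close> is a function on \<^term>\<open>{2..r}\<close>, an element of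
  \<^term>\<open>space (Pi\<^sub>M {2..r} (\<lambda>_. borel))\<close>.\<close>

definition local_mixture ::
    "(real \<Rightarrow> real \<Rightarrow> real) \<Rightarrow> nat \<Rightarrow> real \<Rightarrow> real \<Rightarrow> (nat \<Rightarrow> real) \<Rightarrow> real" where
  "local_mixture f r x \<mu> l = f x \<mu> + (\<Sum>k=2..r. l k * param_deriv f k x \<mu>)"


section \<open>Compact coverings and mixing distributions\<close>

definition compact_covering :: "real set \<Rightarrow> (real \<Rightarrow> real set) \<Rightarrow> bool" where
  "compact_covering S M \<longleftrightarrow> (\<forall>\<mu>\<in>S. compact (M \<mu>) \<and> M \<mu> \<subseteq> S \<and> \<mu> \<in> M \<mu>)"

text \<open>For a nonempty compact set the supremum and infimum are the maximum and minimum
  (\<^const>\<open>Max\<close> and \<^const>\<open>Min\<close> are meaningful for finite sets only).\<close>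

definition set_length :: "real set \<Rightarrow> real" where
  "set_length M = Sup M - Inf M"

definition mixing :: "real set \<Rightarrow> real \<Rightarrow> real measure set" where
  "mixing M \<mu> = {Q \<in> space (prob_algebra borel). (AE m in Q. m \<in> M) \<and> (\<integral>m. m \<partial>Q) = \<mu>}"

definition finite_mixing :: "real set \<Rightarrow> real \<Rightarrow> real measure set" where
  "finite_mixing M \<mu> = {Q \<in> mixing M \<mu>. \<exists>A. finite A \<and> (AE m in Q. m \<in> A)}"

definition moment_map :: "nat \<Rightarrow> real \<Rightarrow> real measure \<Rightarrow> nat \<Rightarrow> real" where
  "moment_map r \<mu> Q = (\<lambda>k\<in>{2..r}. (\<integral>m. (m - \<mu>) ^ k \<partial>Q) / fact k)"

definition moment_set :: "nat \<Rightarrow> real set \<Rightarrow> real \<Rightarrow> (nat \<Rightarrow> real) set" where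
  "moment_set r M \<mu> = moment_map r \<mu> ` finite_mixing M \<mu>"

text \<open>A measure over the finite mixing distributions lives on the sigma-algebra they inherit from
  the Giry monad, i.e. the one generated by the evaluations \<open>Q \<mapsto> Q(A)\<close>. The corresponding
  integration over \<open>\<lambda>\<close> is with respect to the image measure under the weighted moment map.\<close>

definition measure_on_finite_mixing :: "real set \<Rightarrow> real \<Rightarrow> real measure measure \<Rightarrow> bool" where
  "measure_on_finite_mixing M \<mu> P \<longleftrightarrow>
     sets P = sets (restrict_space (prob_algebra borel) (finite_mixing M \<mu>))"

definition moment_measure ::
    "nat \<Rightarrow> real set \<Rightarrow> real \<Rightarrow> real measure measure \<Rightarrow> (nat \<Rightarrow> real) measure" where
  "moment_measure r M \<mu> P =
     distr P (restrict_space (Pi\<^sub>M {2..r} (\<lambda>_. borel)) (moment_set r M \<mu>)) (moment_map r \<mu>)"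

definition prior_density :: "'a measure \<Rightarrow> ('a \<Rightarrow> real) \<Rightarrow> bool" where
  "prior_density P p \<longleftrightarrow> integrable P p \<and> (\<forall>q\<in>space P. 0 \<le> p q)"

end

theory Submission
  imports Defs
begin

text \<open>The prior on the moments is the Radon-Nikodym derivative, with respect to the image of \<open>P\<close>, of the
  image of \<open>\<pi>(\<mu>, Q) dP(Q)\<close> under the moment map; the integral over \<open>\<lambda>\<close> then equals an integral over
  \<open>Q\<close> of \<open>g(x\<^sub>i; \<mu>, \<Phi>(Q))\<close> against the original prior. Taylor expansion at \<open>\<mu>\<close> shows that
  \<open>\<integral> f(x\<^sub>i; m) dQ(m)\<close> and \<open>g(x\<^sub>i; \<mu>, \<Phi>(Q))\<close> differ by \<open>O(|M(\<mu>)|\<^bsup>r+1\<^esup>)\<close> uniformly in \<open>Q\<close>, the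
  linear term vanishing because \<open>Q\<close> has mean \<open>\<mu>\<close>. As \<open>M(\<mu>)\<close> need not be an interval, the expansion
  takes place on a ball around \<open>\<mu>\<close> that contains \<open>M(\<mu>)\<close> for small \<open>\<epsilon>\<close>.\<close>

section \<open>Perturbation of finite products\<close>

text \<open>After division by \<open>B\<close> all factors lie in the unit interval around 0, where
  products differ by at most the sum of the factorwise differences. Since \<open>1 \<le> B\<close>,
  the division does not enlarge these differences; scaling back costs
  \<open>B ^ card I\<close>.\<close>

lemma abs_prod_diff_le:
  fixes a b :: "'a \<Rightarrow> real" and B D :: real
  assumes "finite I" "1 \<le> B" "\<And>i. i \<in> I \<Longrightarrow> \<bar>a i\<bar> \<le> B" "\<And>i. i \<in> I \<Longrightarrow> \<bar>b i\<bar> \<le> B"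
    "\<And>i. i \<in> I \<Longrightarrow> \<bar>a i - b i\<bar> \<le> D"
  shows "\<bar>prod a I - prod b I\<bar> \<le> card I * B ^ card I * D"
proof -
  have "\<bar>(\<Prod>i\<in>I. a i / B) - (\<Prod>i\<in>I. b i / B)\<bar> \<le> (\<Sum>i\<in>I. \<bar>a i / B - b i / B\<bar>)"
    using norm_prod_diff[of I "\<lambda>i. a i / B" "\<lambda>i. b i / B"] assms by (auto simp: field_simps)
  also have "\<dots> \<le> (\<Sum>i\<in>I. D)"
  proof (rule sum_mono)
    fix i assume i: "i \<in> I"
    have "\<bar>a i / B - b i / B\<bar> = \<bar>a i - b i\<bar> / B"
      using assms(2) by (simp flip: diff_divide_distrib)
    also have "\<dots> \<le> \<bar>a i - b i\<bar>"
      using assms(2) by (simp add: divide_le_eq mult_le_cancel_left1)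
    finally show "\<bar>a i / B - b i / B\<bar> \<le> D" using assms(5)[OF i] by simp
  qed
  finally have "\<bar>(\<Prod>i\<in>I. a i / B) - (\<Prod>i\<in>I. b i / B)\<bar> \<le> card I * D" by simp
  then have "\<bar>prod a I - prod b I\<bar> / B ^ card I \<le> card I * D"
    using assms(2) by (simp add: prod_dividef flip: diff_divide_distrib)
  then show ?thesis
    using assms(2) by (simp add: divide_le_eq mult_ac)
qed

section \<open>Transport of a prior along a measurable map\<close>

text \<open>The image \<open>W\<close> of \<open>p dP\<close> is finite because \<open>p\<close> is
  integrable, and absolutely continuous because null sets of the image of \<open>P\<close> pull back
  to null sets of \<open>P\<close>. Its density \<open>D\<close> depends on no test function: both
  sides of the identity are the integral of \<open>h\<close> against \<open>W\<close>.\<close>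

lemma pushforward_density:
  fixes p :: "'a \<Rightarrow> real"
  assumes T [measurable]: "T \<in> P \<rightarrow>\<^sub>M N"
    and p: "prior_density P p"
    and sf: "sigma_finite_measure (distr P N T)"
  shows "\<exists>D. prior_density (distr P N T) D \<and>
    (\<forall>h\<in>borel_measurable N. (\<integral>l. h l * D l \<partial>distr P N T) = (\<integral>q. h (T q) * p q \<partial>P))"
proof -
  have p_int: "integrable P p" and p_nn: "\<And>q. q \<in> space P \<Longrightarrow> 0 \<le> p q"
    using p by (auto simp: prior_density_def)
  have [measurable]: "p \<in> borel_measurable P" using p_int by simp
  have nn: "AE q in P. 0 \<le> p q" using p_nn by auto
  define W where "W = distr (density P p) N T"
  interpret sigma_finite_measure "distr P N T" by fact
  have fin: "finite_measure W"
  proof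
    have "emeasure W (space W) = (\<integral>\<^sup>+q. p q \<partial>P)"
      unfolding W_def
      by (auto simp: emeasure_distr emeasure_density measurable_space[OF T] indicator_def
          intro!: nn_integral_cong)
    also have "\<dots> = ennreal (\<integral>q. p q \<partial>P)"
      by (rule nn_integral_eq_integral[OF p_int nn])
    finally show "emeasure W (space W) \<noteq> \<infinity>" by simp
  qed
  have ac: "absolutely_continuous (distr P N T) W"
    unfolding absolutely_continuous_def
  proof
    fix A assume "A \<in> null_sets (distr P N T)"
    then have A [measurable]: "A \<in> sets N" and "T -` A \<inter> space P \<in> null_sets P"
      by (auto simp: null_sets_distr_iff)
    then have "T -` A \<inter> space P \<in> null_sets (density P p)"
      using absolutely_continuousI_density[of p P] by (auto simp: absolutely_continuous_def)
    then show "A \<in> null_sets W"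
      by (simp add: W_def null_sets_distr_iff)
  qed
  have sW: "sets W = sets (distr P N T)" by (simp add: W_def)
  \<comment> \<open>Finiteness of \<open>W\<close> makes the derivative almost everywhere finite, so
    a real version exists; it is nonnegative at every point, as \<open>prior_density\<close>
    demands.\<close>
  from real_RN_deriv[OF fin ac sW] obtain D where
    D: "D \<in> borel_measurable (distr P N T)" "AE l in distr P N T. RN_deriv (distr P N T) W l = ennreal (D l)"
      "\<And>l. 0 \<le> D l"
    by metis
  have [measurable]: "D \<in> borel_measurable N" using D(1) by simp
  have W_eq: "density (distr P N T) D = W"
  proof -
    have "density (distr P N T) D = density (distr P N T) (RN_deriv (distr P N T) W)"
      using D by (intro density_cong) auto
    also have "\<dots> = W" by (rule density_RN_deriv[OF ac sW])
    finally show ?thesis .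
  qed
  \<comment> \<open>Integrability of \<open>D\<close> is integrability of the constant 1 against the
    finite measure \<open>W\<close>, read through \<open>W_eq\<close>.\<close>
  have "integrable W (\<lambda>_. 1 :: real)"
    using fin by (simp add: finite_measure.integrable_const)
  then have "integrable (distr P N T) D"
    unfolding W_eq[symmetric] using D by (subst (asm) integrable_density) auto
  moreover have "(\<integral>l. h l * D l \<partial>distr P N T) = (\<integral>q. h (T q) * p q \<partial>P)"
    if [measurable]: "h \<in> borel_measurable N" for h
  proof -
    have "(\<integral>l. h l * D l \<partial>distr P N T) = integral\<^sup>L (density (distr P N T) D) h"
      using D(3) by (subst integral_density) (auto simp: mult_ac)
    also have "\<dots> = integral\<^sup>L (density P p) (\<lambda>q. h (T q))"
      unfolding W_eq W_def by (subst integral_distr) auto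
    also have "\<dots> = (\<integral>q. h (T q) * p q \<partial>P)"
      using nn by (subst integral_density) (auto simp: mult_ac)
    finally show ?thesis .
  qed
  ultimately show ?thesis using D(3) by (auto simp: prior_density_def intro!: exI[of _ D])
qed

section \<open>Taylor expansion, pointwise and under a mixing distribution\<close>

text \<open>This is the Lagrange form of the remainder: the intermediate point stays in the ball,
  where the derivative of order \<open>r + 1\<close> is continuous and hence bounded. The factorial
  in the denominator is at least 1 and is dropped.\<close>

lemma Taylor_remainder_bound:
  fixes g :: "real \<Rightarrow> real"
  assumes smooth: "\<And>k m. m \<in> cball \<mu> \<delta> \<Longrightarrow> (deriv ^^ k) g differentiable at m"
  shows "\<exists>K\<ge>0. \<forall>m\<in>cball \<mu> \<delta>.
      \<bar>g m - (\<Sum>k\<le>r. (deriv ^^ k) g \<mu> / fact k * (m - \<mu>) ^ k)\<bar> \<le> K * \<bar>m - \<mu>\<bar> ^ Suc r"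
proof -
  have "compact ((deriv ^^ Suc r) g ` cball \<mu> \<delta>)"
    by (intro compact_continuous_image continuous_at_imp_continuous_on ballI
        differentiable_imp_continuous_within smooth) auto
  then obtain K where K: "\<And>m. m \<in> cball \<mu> \<delta> \<Longrightarrow> \<bar>(deriv ^^ Suc r) g m\<bar> \<le> K"
    by (force dest!: compact_imp_bounded simp: bounded_iff)
  have D: "DERIV ((deriv ^^ k) g) m :> (deriv ^^ Suc k) g m" if "m \<in> cball \<mu> \<delta>" for k m
    using smooth[OF that, of k] by (simp add: DERIV_deriv_iff_real_differentiable)
  have "\<bar>g m - (\<Sum>k\<le>r. (deriv ^^ k) g \<mu> / fact k * (m - \<mu>) ^ k)\<bar> \<le> \<bar>K\<bar> * \<bar>m - \<mu>\<bar> ^ Suc r"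
    if m: "m \<in> cball \<mu> \<delta>" for m
  \<comment> \<open>The Lagrange form requires two distinct points; at the centre itself only the
    term of order 0 survives.\<close>
  proof (cases "m = \<mu>")
    case True
    then show ?thesis by (simp add: power_0_left if_distrib cong: if_cong sum.cong)
  next
    case False
    have "\<exists>t. (if m < \<mu> then m < t \<and> t < \<mu> else \<mu> < t \<and> t < m) \<and>
      g m = (\<Sum>k<Suc r. (deriv ^^ k) g \<mu> / fact k * (m - \<mu>) ^ k)
        + (deriv ^^ Suc r) g t / fact (Suc r) * (m - \<mu>) ^ Suc r"
      using m False
      by (intro Taylor[where a = "\<mu> - \<delta>" and b = "\<mu> + \<delta>"] allI impI D)
        (auto simp: dist_real_def)
    then obtain t where t: "if m < \<mu> then m < t \<and> t < \<mu> else \<mu> < t \<and> t < m"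
      "g m = (\<Sum>k\<le>r. (deriv ^^ k) g \<mu> / fact k * (m - \<mu>) ^ k)
        + (deriv ^^ Suc r) g t / fact (Suc r) * (m - \<mu>) ^ Suc r"
      unfolding lessThan_Suc_atMost by blast
    have "t \<in> cball \<mu> \<delta>" using t(1) m by (auto simp: dist_real_def split: if_splits)
    then have "\<bar>(deriv ^^ Suc r) g t\<bar> \<le> \<bar>K\<bar>" using K by fastforce
    moreover have "\<bar>K\<bar> / fact (Suc r) \<le> \<bar>K\<bar>"
      using fact_ge_1[of "Suc r", where 'a = real]
      by (simp only: divide_le_eq mult_le_cancel_left1) auto
    ultimately have "\<bar>(deriv ^^ Suc r) g t\<bar> / fact (Suc r) \<le> \<bar>K\<bar>"
      by (meson divide_right_mono fact_ge_zero order_trans)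
    then have "\<bar>(deriv ^^ Suc r) g t\<bar> / fact (Suc r) * \<bar>m - \<mu>\<bar> ^ Suc r \<le> \<bar>K\<bar> * \<bar>m - \<mu>\<bar> ^ Suc r"
      by (rule mult_right_mono) simp
    then show ?thesis by (simp add: t(2) abs_mult power_abs del: funpow.simps power_Suc fact_Suc)
  qed
  then show ?thesis by (intro exI[of _ "\<bar>K\<bar>"]) simp
qed

text \<open>Integrating the Taylor polynomial against \<open>Q\<close> turns powers into central
  moments: order 0 gives 1, order 1 gives 0 because the mean is \<open>\<mu>\<close>, and orders 2
  to \<open>r\<close> remain. As \<open>g\<close> is controlled only on \<open>M\<close>, integrals
  pass through the indicator of \<open>M\<close>.\<close>

lemma mixing_Taylor_bound:
  fixes g :: "real \<Rightarrow> real"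
  assumes Q: "Q \<in> mixing M \<mu>" and M: "compact M" "M \<subseteq> cball \<mu> L" and "0 \<le> L"
    and cont: "continuous_on M g" and r: "1 \<le> r" and K: "0 \<le> K"
    and rem: "\<And>m. m \<in> M \<Longrightarrow> \<bar>g m - (\<Sum>k\<le>r. c k * (m - \<mu>) ^ k)\<bar> \<le> K * \<bar>m - \<mu>\<bar> ^ Suc r"
  shows "\<bar>(LINT m:M|Q. g m) - (c 0 + (\<Sum>k=2..r. c k * (\<integral>m. (m - \<mu>) ^ k \<partial>Q)))\<bar> \<le> K * L ^ Suc r"
proof -
  have ps: "prob_space Q" and sQ [measurable_cong]: "sets Q = sets borel" and AE: "AE m in Q. m \<in> M"
    and mean: "(\<integral>m. m \<partial>Q) = \<mu>"
    using Q by (auto simp: mixing_def space_prob_algebra)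
  interpret prob_space Q by fact
  have [measurable]: "M \<in> sets borel" using M(1) by (simp add: compact_imp_closed)
  have int: "integrable Q (\<lambda>m. indicator M m * h m)" if "continuous_on M h" for h :: "real \<Rightarrow> real"
  proof -
    have "bounded (h ` M)"
      using that M(1) by (intro compact_imp_bounded compact_continuous_image)
    then obtain B where B: "\<And>m. m \<in> M \<Longrightarrow> \<bar>h m\<bar> \<le> B"
      by (auto simp: bounded_iff)
    have "(\<lambda>m. indicator M m * h m) \<in> borel_measurable borel"
      using borel_measurable_continuous_on_indicator[OF _ that] by simp
    then have "(\<lambda>m. indicator M m * h m) \<in> borel_measurable Q"
      by (simp add: measurable_cong_sets[OF sQ refl])
    then show ?thesis
      by (rule integrable_const_bound[where B = "\<bar>B\<bar>", rotated])
        (use B in \<open>fastforce simp: indicator_def split: if_splits\<close>)+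
  qed
  \<comment> \<open>Removing the indicator is harmless because \<open>Q\<close> is concentrated on
    \<open>M\<close>; the powers to which this is applied are Borel on the whole line.\<close>
  have drop: "integral\<^sup>L Q (\<lambda>m. indicator M m * h m) = integral\<^sup>L Q h"
    if [measurable]: "h \<in> borel_measurable borel" for h :: "real \<Rightarrow> real"
    using AE by (intro integral_cong_AE) (auto simp: indicator_def)
  have int_pow: "integrable Q (\<lambda>m. indicator M m * (m - \<mu>) ^ k)" for k
    by (intro int continuous_intros)
  \<comment> \<open>Splitting the first central moment into mean minus \<open>\<mu>\<close> needs
    the identity to be integrable. This follows from boundedness of \<open>M\<close>, the mean
    condition alone not stating it.\<close>
  have int_id: "integrable Q (\<lambda>m. m)"
    using int[OF continuous_on_id] AE
    by (rule_tac integrable_cong_AE_imp[of Q "\<lambda>m. indicator M m * m"]) (auto simp: indicator_def)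
  define h where "h m = indicator M m * (g m - (\<Sum>k\<le>r. c k * (m - \<mu>) ^ k))" for m
  have "(\<integral>m. h m \<partial>Q) = (\<integral>m. indicator M m * g m - (\<Sum>k\<le>r. c k * (indicator M m * (m - \<mu>) ^ k)) \<partial>Q)"
    by (intro Bochner_Integration.integral_cong refl)
      (simp add: h_def right_diff_distrib sum_distrib_left mult_ac)
  also have "\<dots> = (LINT m:M|Q. g m) - (\<Sum>k\<le>r. c k * (\<integral>m. indicator M m * (m - \<mu>) ^ k \<partial>Q))"
    using int[OF cont] int_pow
    by (simp add: set_lebesgue_integral_def Bochner_Integration.integral_sum)
  also have "(\<Sum>k\<le>r. c k * (\<integral>m. indicator M m * (m - \<mu>) ^ k \<partial>Q)) = (\<Sum>k\<le>r. c k * (\<integral>m. (m - \<mu>) ^ k \<partial>Q))"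
    by (simp add: drop)
  also have "{..r} = insert 0 (insert 1 {2..r})" using r by auto
  also have "(\<Sum>k\<in>insert 0 (insert 1 {2..r}). c k * (\<integral>m. (m - \<mu>) ^ k \<partial>Q))
      = c 0 + (\<Sum>k=2..r. c k * (\<integral>m. (m - \<mu>) ^ k \<partial>Q))"
    using int_id mean by (simp add: prob_space)
  finally have eq: "(\<integral>m. h m \<partial>Q)
    = (LINT m:M|Q. g m) - (c 0 + (\<Sum>k=2..r. c k * (\<integral>m. (m - \<mu>) ^ k \<partial>Q)))" .
  have int_h: "integrable Q h"
    unfolding h_def by (intro int continuous_intros cont)
  \<comment> \<open>The bound holds everywhere, since \<open>h\<close> vanishes off
    \<open>M\<close>, so it can be integrated against the probability measure
    \<open>Q\<close>.\<close>
  have bound: "\<bar>h m\<bar> \<le> K * L ^ Suc r" for m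
  proof (cases "m \<in> M")
    case True
    then have "\<bar>m - \<mu>\<bar> \<le> L" using M(2) by (auto simp: dist_real_def)
    then have "K * \<bar>m - \<mu>\<bar> ^ Suc r \<le> K * L ^ Suc r"
      using K by (intro mult_left_mono power_mono) auto
    then show ?thesis using rem[OF True] True by (simp add: h_def)
  qed (use K \<open>0 \<le> L\<close> in \<open>simp add: h_def\<close>)
  have "\<bar>\<integral>m. h m \<partial>Q\<bar> \<le> (\<integral>m. \<bar>h m\<bar> \<partial>Q)" by simp
  also have "\<dots> \<le> K * L ^ Suc r"
    using bound int_h by (intro integral_le_const) auto
  finally show ?thesis unfolding eq .
qed

section \<open>Measurability on the space of finite mixing distributions\<close>

lemma measurable_integral_finite_mixing:
  fixes h :: "real \<Rightarrow> real"
  assumes P: "measure_on_finite_mixing M \<mu> P" and h: "h \<in> borel_measurable borel"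
  shows "(\<lambda>Q. integral\<^sup>L Q h) \<in> borel_measurable P"
proof -
  have "(\<lambda>Q. integral\<^sup>L Q h) \<in> borel_measurable (prob_algebra borel)"
    using integral_measurable_subprob_algebra[OF h]
    unfolding prob_algebra_def by (rule measurable_restrict_space1)
  then have "(\<lambda>Q. integral\<^sup>L Q h) \<in> borel_measurable (restrict_space (prob_algebra borel) (finite_mixing M \<mu>))"
    by (rule measurable_restrict_space1)
  then show ?thesis
    using P unfolding measure_on_finite_mixing_def by (simp cong: measurable_cong_sets)
qed

lemma space_measure_on_finite_mixing:
  assumes "measure_on_finite_mixing M \<mu> P"
  shows "space P = finite_mixing M \<mu>"
  using sets_eq_imp_space_eq[OF assms[unfolded measure_on_finite_mixing_def]]
  by (auto simp: space_restrict_space finite_mixing_def mixing_def)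

text \<open>The target carries the trace sigma-algebra on \<open>moment_set\<close>, so it suffices
  that values land in that set and that every coordinate, an integral against \<open>Q\<close>, is
  measurable.\<close>

lemma measurable_moment_map:
  assumes P: "measure_on_finite_mixing M \<mu> P"
  shows "moment_map r \<mu> \<in> P \<rightarrow>\<^sub>M restrict_space (Pi\<^sub>M {2..r} (\<lambda>_. borel)) (moment_set r M \<mu>)"
proof (rule measurable_restrict_space2)
  show "moment_map r \<mu> \<in> space P \<rightarrow> moment_set r M \<mu>"
    by (auto simp: moment_set_def space_measure_on_finite_mixing[OF P])
  have [measurable]: "(\<lambda>Q. \<integral>m. (m - \<mu>) ^ k \<partial>Q) \<in> borel_measurable P" for k
    by (rule measurable_integral_finite_mixing[OF P]) simp
  show "moment_map r \<mu> \<in> P \<rightarrow>\<^sub>M Pi\<^sub>M {2..r} (\<lambda>_. borel)"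
    unfolding moment_map_def by measurable
qed

lemma measurable_local_mixture:
  "local_mixture f r x \<mu> \<in> borel_measurable (restrict_space (Pi\<^sub>M {2..r} (\<lambda>_. borel)) \<Lambda>)"
proof (rule measurable_restrict_space1)
  show "local_mixture f r x \<mu> \<in> borel_measurable (Pi\<^sub>M {2..r} (\<lambda>_. borel))"
    unfolding local_mixture_def[abs_def]
    by (intro borel_measurable_add borel_measurable_sum borel_measurable_times
        measurable_component_singleton) auto
qed

section \<open>Bounds from the supporting set\<close>

text \<open>A non-integrable function has integral 0 by convention, which is why
  \<open>0 \<le> B\<close> covers that case.\<close>

lemma abs_set_integral_le:
  fixes g :: "'a \<Rightarrow> real"
  assumes "prob_space Q" "0 \<le> B" "\<And>m. m \<in> M \<Longrightarrow> \<bar>g m\<bar> \<le> B"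
  shows "\<bar>LINT m:M|Q. g m\<bar> \<le> B"
proof (cases "set_integrable Q M g")
  case True
  interpret prob_space Q by fact
  have "\<bar>LINT m:M|Q. g m\<bar> \<le> (\<integral>m. \<bar>indicator M m * g m\<bar> \<partial>Q)"
    unfolding set_lebesgue_integral_def by simp
  also have "\<dots> \<le> B"
    using True assms(2,3)
    by (intro integral_le_const) (auto simp: set_integrable_def indicator_def)
  finally show ?thesis .
qed (use assms(2) in \<open>simp add: set_lebesgue_integral_def set_integrable_def not_integrable_integral_eq\<close>)

text \<open>This turns control of the length of the covering set into the radius needed for a Taylor
  expansion at \<open>\<mu>\<close>.\<close>

lemma subset_cball_set_length:
  assumes "compact M" "\<mu> \<in> M"
  shows "M \<subseteq> cball \<mu> (set_length M)"
proof
  fix m assume "m \<in> M"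
  moreover have "bdd_above M" "bdd_below M"
    using assms(1) by (auto dest!: compact_imp_bounded simp: bounded_imp_bdd_above bounded_imp_bdd_below)
  ultimately have "m \<le> Sup M" "\<mu> \<le> Sup M" "Inf M \<le> m" "Inf M \<le> \<mu>"
    using assms(2) by (auto intro: cSup_upper cInf_lower)
  then show "m \<in> cball \<mu> (set_length M)"
    by (auto simp: set_length_def dist_real_def)
qed

section \<open>Construction of the prior and rate of the error\<close>

theorem theorem6:
  fixes \<nu> :: "real measure"
    and f :: "real \<Rightarrow> real \<Rightarrow> real"
    and r :: nat
    and \<epsilon>0 :: real
    and M :: "real \<Rightarrow> real \<Rightarrow> real set"
    and P :: "real \<Rightarrow> real \<Rightarrow> real measure measure"
    and prior :: "real \<Rightarrow> real \<Rightarrow> real measure \<Rightarrow> real"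
  assumes "regular_exponential_family \<nu>"
    and f: "f = mean_density \<nu>"
    and "regular_parametric_family \<nu> (mean_space \<nu>) f"
    and "r \<ge> 2"
    and "\<epsilon>0 > 0"
    and "\<And>\<epsilon>. \<epsilon> \<in> {0<..<\<epsilon>0} \<Longrightarrow> compact_covering (mean_space \<nu>) (M \<epsilon>)"
    and "\<And>\<mu>. \<mu> \<in> mean_space \<nu> \<Longrightarrow>
           (\<lambda>\<epsilon>. set_length (M \<epsilon> \<mu>)) \<in> O[at_right 0](\<lambda>\<epsilon>. \<epsilon> powr (1 / 2))"
    and "\<And>\<epsilon> \<mu>. \<epsilon> \<in> {0<..<\<epsilon>0} \<Longrightarrow> \<mu> \<in> mean_space \<nu> \<Longrightarrow>
           measure_on_finite_mixing (M \<epsilon> \<mu>) \<mu> (P \<epsilon> \<mu>) \<and>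
           sigma_finite_measure (moment_measure r (M \<epsilon> \<mu>) \<mu> (P \<epsilon> \<mu>))"
    and "\<And>\<epsilon> \<mu>. \<epsilon> \<in> {0<..<\<epsilon>0} \<Longrightarrow> \<mu> \<in> mean_space \<nu> \<Longrightarrow>
           prior_density (P \<epsilon> \<mu>) (prior \<epsilon> \<mu>)"
    and "\<And>\<mu>. \<mu> \<in> mean_space \<nu> \<Longrightarrow>
           (\<lambda>\<epsilon>. \<integral>Q. prior \<epsilon> \<mu> Q \<partial>P \<epsilon> \<mu>) \<in> O[at_right 0](\<lambda>_. 1)"
  shows "\<exists>prior' :: real \<Rightarrow> real \<Rightarrow> (nat \<Rightarrow> real) \<Rightarrow> real.
      (\<forall>\<epsilon>\<in>{0<..<\<epsilon>0}. \<forall>\<mu>\<in>mean_space \<nu>.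
         prior_density (moment_measure r (M \<epsilon> \<mu>) \<mu> (P \<epsilon> \<mu>)) (prior' \<epsilon> \<mu>) \<and>
         (\<integral>l. prior' \<epsilon> \<mu> l \<partial>moment_measure r (M \<epsilon> \<mu>) \<mu> (P \<epsilon> \<mu>)) = (\<integral>Q. prior \<epsilon> \<mu> Q \<partial>P \<epsilon> \<mu>)) \<and>
      (\<forall>(n :: nat) (x :: nat \<Rightarrow> real). \<forall>\<mu>\<in>mean_space \<nu>.
         (\<exists>C>0. \<forall>\<epsilon>\<in>{0<..<\<epsilon>0}. \<forall>Q\<in>finite_mixing (M \<epsilon> \<mu>) \<mu>. \<forall>i\<in>{1..n}.
            C \<le> local_mixture f r (x i) \<mu> (moment_map r \<mu> Q)) \<longrightarrow>
         (\<exists>R2 :: real \<Rightarrow> real.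
            R2 \<in> O[at_right 0](\<lambda>\<epsilon>. \<epsilon> powr ((real r + 1) / 2)) \<and>
            (\<forall>\<epsilon>\<in>{0<..<\<epsilon>0}.
               \<bar>(\<integral>Q. (\<Prod>i=1..n. LINT m:M \<epsilon> \<mu>|Q. f (x i) m) * prior \<epsilon> \<mu> Q \<partial>P \<epsilon> \<mu>) -
                (\<integral>l. (\<Prod>i=1..n. local_mixture f r (x i) \<mu> l) * prior' \<epsilon> \<mu> l
                   \<partial>moment_measure r (M \<epsilon> \<mu>) \<mu> (P \<epsilon> \<mu>))\<bar> \<le> R2 \<epsilon>)))"
proof -
  define S where "S = mean_space \<nu>"
  define N where "N \<epsilon> \<mu> = restrict_space (Pi\<^sub>M {2..r} (\<lambda>_. borel :: real measure)) (moment_set r (M \<epsilon> \<mu>) \<mu>)"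
    for \<epsilon> \<mu>
  have P: "measure_on_finite_mixing (M \<epsilon> \<mu>) \<mu> (P \<epsilon> \<mu>)"
    and prior: "prior_density (P \<epsilon> \<mu>) (prior \<epsilon> \<mu>)"
    if "\<epsilon> \<in> {0<..<\<epsilon>0}" "\<mu> \<in> S" for \<epsilon> \<mu>
    using assms(8,9) that unfolding S_def by blast+
  have \<Phi>: "moment_map r \<mu> \<in> P \<epsilon> \<mu> \<rightarrow>\<^sub>M N \<epsilon> \<mu>" if "\<epsilon> \<in> {0<..<\<epsilon>0}" "\<mu> \<in> S" for \<epsilon> \<mu>
    unfolding N_def by (intro measurable_moment_map P that)
  \<comment> \<open>Quantifying over all measurable \<open>h\<close> lets one density be fixed
    before \<open>n\<close> and the data \<open>x\<close> are given.\<close>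
  define is_pushforward where "is_pushforward \<epsilon> \<mu> D \<longleftrightarrow>
      prior_density (moment_measure r (M \<epsilon> \<mu>) \<mu> (P \<epsilon> \<mu>)) D \<and>
      (\<forall>h\<in>borel_measurable (N \<epsilon> \<mu>). (\<integral>l. h l * D l \<partial>moment_measure r (M \<epsilon> \<mu>) \<mu> (P \<epsilon> \<mu>))
        = (\<integral>Q. h (moment_map r \<mu> Q) * prior \<epsilon> \<mu> Q \<partial>P \<epsilon> \<mu>))" for \<epsilon> \<mu> D
  have ex: "\<exists>D. is_pushforward \<epsilon> \<mu> D" if "\<epsilon> \<in> {0<..<\<epsilon>0}" "\<mu> \<in> S" for \<epsilon> \<mu>
  proof -
    have mm: "moment_measure r (M \<epsilon> \<mu>) \<mu> (P \<epsilon> \<mu>) = distr (P \<epsilon> \<mu>) (N \<epsilon> \<mu>) (moment_map r \<mu>)"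
      by (simp add: moment_measure_def N_def)
    have "sigma_finite_measure (distr (P \<epsilon> \<mu>) (N \<epsilon> \<mu>) (moment_map r \<mu>))"
      using conjunct2[OF assms(8)[OF that[unfolded S_def]]] unfolding mm .
    from pushforward_density[OF \<Phi>[OF that] prior[OF that] this]
    show ?thesis unfolding is_pushforward_def mm .
  qed
  define prior' where "prior' \<epsilon> \<mu> = (SOME D. is_pushforward \<epsilon> \<mu> D)" for \<epsilon> \<mu>
  have "is_pushforward \<epsilon> \<mu> (prior' \<epsilon> \<mu>)" if "\<epsilon> \<in> {0<..<\<epsilon>0}" "\<mu> \<in> S" for \<epsilon> \<mu>
    unfolding prior'_def using ex[OF that] by (rule someI_ex)
  then have prior': "prior_density (moment_measure r (M \<epsilon> \<mu>) \<mu> (P \<epsilon> \<mu>)) (prior' \<epsilon> \<mu>)"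
    and transfer: "\<And>h. h \<in> borel_measurable (N \<epsilon> \<mu>) \<Longrightarrow>
      (\<integral>l. h l * prior' \<epsilon> \<mu> l \<partial>moment_measure r (M \<epsilon> \<mu>) \<mu> (P \<epsilon> \<mu>))
        = (\<integral>Q. h (moment_map r \<mu> Q) * prior \<epsilon> \<mu> Q \<partial>P \<epsilon> \<mu>)"
    if "\<epsilon> \<in> {0<..<\<epsilon>0}" "\<mu> \<in> S" for \<epsilon> \<mu>
    using that unfolding is_pushforward_def by blast+
  \<comment> \<open>Conservation of total mass is the test function 1.\<close>
  have mass: "(\<integral>l. prior' \<epsilon> \<mu> l \<partial>moment_measure r (M \<epsilon> \<mu>) \<mu> (P \<epsilon> \<mu>)) = (\<integral>Q. prior \<epsilon> \<mu> Q \<partial>P \<epsilon> \<mu>)"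
    if "\<epsilon> \<in> {0<..<\<epsilon>0}" "\<mu> \<in> S" for \<epsilon> \<mu>
    using transfer[OF that, of "\<lambda>_. 1"] by simp
  have "open S" and smooth: "\<And>x k m. m \<in> S \<Longrightarrow> (deriv ^^ k) (f x) differentiable at m"
    using assms(3) unfolding regular_parametric_family_def param_deriv_def S_def by auto
  \<comment> \<open>The error itself will serve as \<open>R2\<close>, so only its rate has to be
    established.\<close>
  have error: "(\<lambda>\<epsilon>. \<bar>(\<integral>Q. (\<Prod>i=1..n. LINT m:M \<epsilon> \<mu>|Q. f (x i) m) * prior \<epsilon> \<mu> Q \<partial>P \<epsilon> \<mu>) -
        (\<integral>l. (\<Prod>i=1..n. local_mixture f r (x i) \<mu> l) * prior' \<epsilon> \<mu> l
           \<partial>moment_measure r (M \<epsilon> \<mu>) \<mu> (P \<epsilon> \<mu>))\<bar>)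
      \<in> O[at_right 0](\<lambda>\<epsilon>. \<epsilon> powr ((real r + 1) / 2))" (is "?err \<in> _")
    if \<mu>: "\<mu> \<in> S" for n :: nat and x :: "nat \<Rightarrow> real" and \<mu>
  proof -
    \<comment> \<open>The radius depends on \<open>\<mu>\<close> alone. All Taylor constants and
      bounds below come from this fixed ball and are therefore uniform in \<open>\<epsilon>\<close>
      and \<open>Q\<close>.\<close>
    obtain \<delta> where "0 < \<delta>" and \<delta>: "cball \<mu> \<delta> \<subseteq> S"
      using \<open>open S\<close> \<mu> open_contains_cball by blast
    define rem where "rem i m = \<bar>f (x i) m - (\<Sum>k\<le>r. (deriv ^^ k) (f (x i)) \<mu> / fact k * (m - \<mu>) ^ k)\<bar>"
      for i m
    have "\<forall>i. \<exists>K\<ge>0. \<forall>m\<in>cball \<mu> \<delta>. rem i m \<le> K * \<bar>m - \<mu>\<bar> ^ Suc r"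
    proof
      fix i
      have "(deriv ^^ k) (f (x i)) differentiable at m" if "m \<in> cball \<mu> \<delta>" for k m
        using smooth \<delta> that by blast
      from Taylor_remainder_bound[OF this]
      show "\<exists>K\<ge>0. \<forall>m\<in>cball \<mu> \<delta>. rem i m \<le> K * \<bar>m - \<mu>\<bar> ^ Suc r"
        unfolding rem_def .
    qed
    from choice[OF this] obtain K where "\<forall>i. 0 \<le> K i \<and> (\<forall>m\<in>cball \<mu> \<delta>. rem i m \<le> K i * \<bar>m - \<mu>\<bar> ^ Suc r)"
      by (rule exE)
    then have K_nn: "\<And>i. 0 \<le> K i"
      and K: "\<And>i m. m \<in> cball \<mu> \<delta> \<Longrightarrow> rem i m \<le> K i * \<bar>m - \<mu>\<bar> ^ Suc r"
      by blast+
    have f_cont: "continuous_on S (f y)" for y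
      using smooth[of _ 0 y] by (auto intro!: continuous_at_imp_continuous_on differentiable_imp_continuous_within)
    have "bounded (f (x i) ` cball \<mu> \<delta>)" for i
      using continuous_on_subset[OF f_cont \<delta>] by (intro compact_imp_bounded compact_continuous_image) auto
    then have "\<forall>i. \<exists>B. \<forall>m\<in>cball \<mu> \<delta>. \<bar>f (x i) m\<bar> \<le> B"
      by (simp add: bounded_iff)
    from choice[OF this] obtain B where "\<forall>i. \<forall>m\<in>cball \<mu> \<delta>. \<bar>f (x i) m\<bar> \<le> B i"
      by (rule exE)
    then have B: "\<And>i m. m \<in> cball \<mu> \<delta> \<Longrightarrow> \<bar>f (x i) m\<bar> \<le> B i"
      by blast
    have B_nn: "0 \<le> B i" for i
      using B[of \<mu> i] \<open>0 < \<delta>\<close> by (auto intro: order_trans[OF abs_ge_zero])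
    \<comment> \<open>Sums dominate each summand and also make sense for \<open>n = 0\<close>. In
      \<open>B'\<close>, the term \<open>K' * \<delta> ^ Suc r\<close> leaves room for the local
      mixture, bounded only through its distance to the true mixture, and the 1 secures
      \<open>1 \<le> B'\<close>.\<close>
    define K' where "K' = (\<Sum>i=1..n. K i)"
    define B' where "B' = 1 + (\<Sum>i=1..n. B i) + K' * \<delta> ^ Suc r"
    have K'_nn: "0 \<le> K'" and K'_ge: "\<And>i. i \<in> {1..n} \<Longrightarrow> K i \<le> K'"
      unfolding K'_def using K_nn by (auto intro: sum_nonneg member_le_sum)
    have B'_ge: "B i + K' * \<delta> ^ Suc r \<le> B'" if "i \<in> {1..n}" for i
      using member_le_sum[of i "{1..n}" B] that B_nn by (auto simp: B'_def)
    have B'1: "1 \<le> B'"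
      unfolding B'_def using B_nn K'_nn \<open>0 < \<delta>\<close> by (simp add: sum_nonneg add_nonneg_nonneg)
    obtain c where "0 < c"
      and c: "\<forall>\<^sub>F \<epsilon> in at_right 0. norm (set_length (M \<epsilon> \<mu>)) \<le> c * norm (\<epsilon> powr (1 / 2) :: real)"
      using landau_o.bigE[OF assms(7)] \<mu> unfolding S_def by blast
    obtain c' where "0 < c'"
      and c': "\<forall>\<^sub>F \<epsilon> in at_right 0. norm (\<integral>Q. prior \<epsilon> \<mu> Q \<partial>P \<epsilon> \<mu>) \<le> c' * norm (1 :: real)"
      using landau_o.bigE[OF assms(10)] \<mu> unfolding S_def by blast
    \<comment> \<open>The majorant of the length tends to 0, so the covering set eventually fits
      into the fixed ball.\<close>
    have "((\<lambda>\<epsilon>. c * \<epsilon> powr (1 / 2)) \<longlongrightarrow> c * 0) (at_right 0)"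
      by (intro tendsto_mult tendsto_zero_powrI[where b = "1 / 2"] tendsto_intros)
        (auto simp: eventually_at_filter)
    then have small: "\<forall>\<^sub>F \<epsilon> in at_right 0. c * \<epsilon> powr (1 / 2) < \<delta>"
      using order_tendstoD(2) \<open>0 < \<delta>\<close> by fastforce
    have range: "\<forall>\<^sub>F \<epsilon> in at_right 0. \<epsilon> \<in> {0<..<\<epsilon>0}"
      using assms(5) by (rule eventually_at_right_real)
    show ?thesis
    proof (rule bigoI)
      show "\<forall>\<^sub>F \<epsilon> in at_right 0. norm (?err \<epsilon>)
        \<le> (n * B' ^ n * K' * c ^ Suc r * c') * norm (\<epsilon> powr ((real r + 1) / 2))"
        using range small c c'
      proof eventually_elim
        case (elim \<epsilon>)
        define L where "L = c * \<epsilon> powr (1 / 2)"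
        have L: "0 \<le> L" "L \<le> \<delta>" using elim(2) \<open>0 < c\<close> by (auto simp: L_def)
        have M: "compact (M \<epsilon> \<mu>)" "\<mu> \<in> M \<epsilon> \<mu>"
          using assms(6)[OF elim(1)] \<mu> by (auto simp: compact_covering_def S_def)
        have sub_L: "M \<epsilon> \<mu> \<subseteq> cball \<mu> L"
          using subset_cball_set_length[OF M] elim(3) subset_cball[of "set_length (M \<epsilon> \<mu>)" L \<mu>]
          by (force simp: L_def)
        then have sub_d: "M \<epsilon> \<mu> \<subseteq> cball \<mu> \<delta>" using L(2) by force
        note PQ = P[OF elim(1) \<mu>]
        have [measurable]: "M \<epsilon> \<mu> \<in> sets borel" using M(1) by (simp add: compact_imp_closed)
        have cont: "continuous_on (M \<epsilon> \<mu>) (f y)" for y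
          using f_cont continuous_on_subset sub_d \<delta> by (metis order_trans)
        define a where "a Q i = (LINT m:M \<epsilon> \<mu>|Q. f (x i) m)" for Q i
        define b where "b Q i = local_mixture f r (x i) \<mu> (moment_map r \<mu> Q)" for Q i
        have [measurable]: "prior \<epsilon> \<mu> \<in> borel_measurable (P \<epsilon> \<mu>)"
          and prior_int: "integrable (P \<epsilon> \<mu>) (prior \<epsilon> \<mu>)"
          and prior_nn: "\<And>Q. Q \<in> space (P \<epsilon> \<mu>) \<Longrightarrow> 0 \<le> prior \<epsilon> \<mu> Q"
          using prior[OF elim(1) \<mu>] by (auto simp: prior_density_def)
        have lm [measurable]: "local_mixture f r y \<mu> \<in> borel_measurable (N \<epsilon> \<mu>)" for y
          unfolding N_def by (rule measurable_local_mixture)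
        have [measurable]: "(\<lambda>Q. a Q i) \<in> borel_measurable (P \<epsilon> \<mu>)" for i
          unfolding a_def set_lebesgue_integral_def
          by (intro measurable_integral_finite_mixing[OF PQ] borel_measurable_continuous_on_indicator cont)
            simp
        have [measurable]: "(\<lambda>Q. b Q i) \<in> borel_measurable (P \<epsilon> \<mu>)" for i
          unfolding b_def by (rule measurable_compose[OF \<Phi>[OF elim(1) \<mu>] lm])
        have prob: "prob_space Q" and mix: "Q \<in> mixing (M \<epsilon> \<mu>) \<mu>" if "Q \<in> space (P \<epsilon> \<mu>)" for Q
          using that
          by (auto simp: space_measure_on_finite_mixing[OF PQ] finite_mixing_def mixing_def space_prob_algebra)
        have ab: "\<bar>a Q i - b Q i\<bar> \<le> K' * L ^ Suc r" if Q: "Q \<in> space (P \<epsilon> \<mu>)" and i: "i \<in> {1..n}" for Q i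
        proof -
          \<comment> \<open>The weights \<open>1 / fact k\<close> of \<open>moment_map\<close>
            become the denominators of the Taylor coefficients.\<close>
          have b_eq: "b Q i = (deriv ^^ 0) (f (x i)) \<mu> / fact 0
              + (\<Sum>k=2..r. (deriv ^^ k) (f (x i)) \<mu> / fact k * (\<integral>m. (m - \<mu>) ^ k \<partial>Q))"
            unfolding b_def local_mixture_def
            by (simp add: moment_map_def param_deriv_def mult_ac)
          show ?thesis
            unfolding a_def b_eq
          proof (rule mixing_Taylor_bound[OF mix[OF Q] M(1) sub_L L(1) cont])
            fix m assume "m \<in> M \<epsilon> \<mu>"
            then have "rem i m \<le> K i * \<bar>m - \<mu>\<bar> ^ Suc r"
              using K sub_d by blast
            also have "\<dots> \<le> K' * \<bar>m - \<mu>\<bar> ^ Suc r"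
              using K'_ge[OF i] by (intro mult_right_mono) auto
            finally show "\<bar>f (x i) m - (\<Sum>k\<le>r. (deriv ^^ k) (f (x i)) \<mu> / fact k * (m - \<mu>) ^ k)\<bar>
                \<le> K' * \<bar>m - \<mu>\<bar> ^ Suc r"
              unfolding rem_def .
          qed (use K'_nn assms(4) in auto)
        qed
        have aB: "\<bar>a Q i\<bar> \<le> B i" if "Q \<in> space (P \<epsilon> \<mu>)" for Q i
          unfolding a_def using B sub_d B_nn by (intro abs_set_integral_le prob that) auto
        have rem_le: "K' * L ^ Suc r \<le> K' * \<delta> ^ Suc r"
          using K'_nn L by (intro mult_left_mono power_mono) auto
        have a_le: "\<bar>a Q i\<bar> \<le> B'" and b_le: "\<bar>b Q i\<bar> \<le> B'"
          if "Q \<in> space (P \<epsilon> \<mu>)" "i \<in> {1..n}" for Q i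
        proof -
          have "0 \<le> K' * L ^ Suc r" using K'_nn L(1) by simp
          then show "\<bar>a Q i\<bar> \<le> B'" "\<bar>b Q i\<bar> \<le> B'"
            using ab[OF that] aB[OF that(1), of i] B'_ge[OF that(2)] rem_le by linarith+
        qed
        \<comment> \<open>Domination by a constant multiple of the prior, stated for a generic
          \<open>h\<close> to serve both the true mixture \<open>a\<close> and the local mixture
          \<open>b\<close>.\<close>
        have int: "integrable (P \<epsilon> \<mu>) (\<lambda>Q. (\<Prod>i=1..n. h Q i) * prior \<epsilon> \<mu> Q)"
          if [measurable]: "\<And>i. (\<lambda>Q. h Q i) \<in> borel_measurable (P \<epsilon> \<mu>)"
            and h: "\<And>Q i. Q \<in> space (P \<epsilon> \<mu>) \<Longrightarrow> i \<in> {1..n} \<Longrightarrow> \<bar>h Q i\<bar> \<le> B'" for h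
        proof (rule Bochner_Integration.integrable_bound)
          show "integrable (P \<epsilon> \<mu>) (\<lambda>Q. B' ^ n * prior \<epsilon> \<mu> Q)" using prior_int by simp
          show "(\<lambda>Q. (\<Prod>i=1..n. h Q i) * prior \<epsilon> \<mu> Q) \<in> borel_measurable (P \<epsilon> \<mu>)" by measurable
          show "AE Q in P \<epsilon> \<mu>. norm ((\<Prod>i=1..n. h Q i) * prior \<epsilon> \<mu> Q) \<le> norm (B' ^ n * prior \<epsilon> \<mu> Q)"
          proof (rule AE_I2)
            fix Q assume Q: "Q \<in> space (P \<epsilon> \<mu>)"
            have "(\<Prod>i=1..n. \<bar>h Q i\<bar>) \<le> (\<Prod>i=1..n. B')"
              using h[OF Q] by (intro prod_mono) auto
            then show "norm ((\<Prod>i=1..n. h Q i) * prior \<epsilon> \<mu> Q) \<le> norm (B' ^ n * prior \<epsilon> \<mu> Q)"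
              using B'1 by (auto simp: abs_mult abs_prod power_abs intro!: mult_right_mono)
          qed
        qed
        have int_a: "integrable (P \<epsilon> \<mu>) (\<lambda>Q. (\<Prod>i=1..n. a Q i) * prior \<epsilon> \<mu> Q)"
          by (rule int) (use a_le in auto)
        have int_b: "integrable (P \<epsilon> \<mu>) (\<lambda>Q. (\<Prod>i=1..n. b Q i) * prior \<epsilon> \<mu> Q)"
          by (rule int) (use b_le in auto)
        \<comment> \<open>The integral over the moments is pulled back to one over \<open>Q\<close>
          with the original prior, so both products are compared under the same measure.\<close>
        have "?err \<epsilon> = \<bar>(\<integral>Q. (\<Prod>i=1..n. a Q i) * prior \<epsilon> \<mu> Q \<partial>P \<epsilon> \<mu>) - (\<integral>Q. (\<Prod>i=1..n. b Q i) * prior \<epsilon> \<mu> Q \<partial>P \<epsilon> \<mu>)\<bar>"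
          unfolding a_def b_def by (subst transfer[OF elim(1) \<mu>]) auto
        also have "\<dots> = \<bar>\<integral>Q. (\<Prod>i=1..n. a Q i) * prior \<epsilon> \<mu> Q - (\<Prod>i=1..n. b Q i) * prior \<epsilon> \<mu> Q \<partial>P \<epsilon> \<mu>\<bar>"
          using int_a int_b by simp
        also have "\<dots> \<le> (\<integral>Q. \<bar>(\<Prod>i=1..n. a Q i) * prior \<epsilon> \<mu> Q - (\<Prod>i=1..n. b Q i) * prior \<epsilon> \<mu> Q\<bar> \<partial>P \<epsilon> \<mu>)"
          by (rule integral_abs_bound)
        \<comment> \<open>The bound on the product difference is constant in \<open>Q\<close>; what
          remains is the mass of the prior, at most \<open>c'\<close>.\<close>
        also have "\<dots> \<le> (\<integral>Q. (n * B' ^ n * (K' * L ^ Suc r)) * prior \<epsilon> \<mu> Q \<partial>P \<epsilon> \<mu>)"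
        proof (rule integral_mono)
          fix Q assume Q: "Q \<in> space (P \<epsilon> \<mu>)"
          have "\<bar>(\<Prod>i=1..n. a Q i) - (\<Prod>i=1..n. b Q i)\<bar> \<le> n * B' ^ n * (K' * L ^ Suc r)"
            using abs_prod_diff_le[of "{1..n}" B' "a Q" "b Q" "K' * L ^ Suc r"] B'1 a_le[OF Q] b_le[OF Q] ab[OF Q]
            by simp
          then show "\<bar>(\<Prod>i=1..n. a Q i) * prior \<epsilon> \<mu> Q - (\<Prod>i=1..n. b Q i) * prior \<epsilon> \<mu> Q\<bar>
              \<le> (n * B' ^ n * (K' * L ^ Suc r)) * prior \<epsilon> \<mu> Q"
            using prior_nn[OF Q] by (simp add: abs_mult mult_right_mono flip: left_diff_distrib)
        qed (use int_a int_b prior_int in auto)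
        also have "\<dots> \<le> (n * B' ^ n * (K' * L ^ Suc r)) * c'"
        proof -
          have "(\<integral>Q. prior \<epsilon> \<mu> Q \<partial>P \<epsilon> \<mu>) \<le> c'" using elim(4) by simp
          then show ?thesis
            using B'1 K'_nn L(1) by (simp add: mult_left_mono)
        qed
        \<comment> \<open>The \<open>r + 1\<close> factors \<open>\<epsilon> powr (1 / 2)\<close>
          from the remainder produce the exponent \<open>(r + 1) / 2\<close>.\<close>
        also have "L ^ Suc r = c ^ Suc r * \<epsilon> powr ((real r + 1) / 2)"
          using elim(1) by (simp add: L_def power_mult_distrib powr_power add.commute flip: power_Suc)
        finally show ?case by (simp add: mult_ac)
      qed
    qed
  qed
  show ?thesis
  proof (rule exI[of _ prior'], intro conjI ballI allI impI)
    fix n :: nat and x :: "nat \<Rightarrow> real" and \<mu>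
    assume "\<mu> \<in> mean_space \<nu>"
    then have "\<mu> \<in> S" by (simp add: S_def)
    from error[OF this, where n = n and x = x] show "\<exists>R2 :: real \<Rightarrow> real.
        R2 \<in> O[at_right 0](\<lambda>\<epsilon>. \<epsilon> powr ((real r + 1) / 2)) \<and>
        (\<forall>\<epsilon>\<in>{0<..<\<epsilon>0}.
           \<bar>(\<integral>Q. (\<Prod>i=1..n. LINT m:M \<epsilon> \<mu>|Q. f (x i) m) * prior \<epsilon> \<mu> Q \<partial>P \<epsilon> \<mu>) -
            (\<integral>l. (\<Prod>i=1..n. local_mixture f r (x i) \<mu> l) * prior' \<epsilon> \<mu> l
               \<partial>moment_measure r (M \<epsilon> \<mu>) \<mu> (P \<epsilon> \<mu>))\<bar> \<le> R2 \<epsilon>)"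
      \<comment> \<open>Matching the first conjunct with the rate just shown instantiates
        \<open>R2\<close> with the error, so the required inequality is reflexivity.\<close>
      by - (rule exI, rule conjI, assumption, intro ballI order_refl)
  qed (use prior' mass in \<open>auto simp: S_def\<close>)
qed

end
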